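(* Let $\boldsymbol{q}$ be a query, let $\mathcal{D}=\{\boldsymbol{d}_1,\dots,\boldsymbol{d}_{N_d}\}$ be a finite set of candidate documents, and let $\epsilon\le 1$ be the perturbation budget. Let $f:\boldsymbol{q}\times\mathcal{D}\to\mathbb{R}$ be a ranking model (also evaluated on perturbed documents) and let $r:\mathbb{R}\times\mathbb{R}\to\{\pm 1,0\}$ be a ranking mechanism (comparing pairs of scores). Let $\pi_f$ be the predicted rank positions, $\pi_y$ the ground-truth rank positions, $\mathbb{B}(\boldsymbol{d},\epsilon)$ the word-substitution neighborhood of a document $\boldsymbol{d}$, and $\mathcal{R}_{\mathrm{bdy}}(f)$ the boundary ranking error of $f$, all as defined in the context. Then $$ \mathcal{R}_{\mathrm{bdy}}(f)\;\le\;\mathbb{E}_{\boldsymbol{d}_i\sim\mathcal{D}}\;\max_{\boldsymbol{d}_i'\in\mathbb{B}(\boldsymbol{d}_i,\epsilon)}\;\mathbb{I}\left\{\pi_f(\boldsymbol{q},\boldsymbol{d}_i)\neq\pi_f(\boldsymbol{q},\boldsymbol{d}_i')\right\}. $$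
   Context: $\mathbb{I}\{\cdot\}$ is the indicator function ($1$ if the event happens, $0$ otherwise). $\mathbb{E}_{\boldsymbol{d}_i\sim\mathcal{D}}$ denotes expectation over documents $\boldsymbol{d}_i$ drawn from $\mathcal{D}$. Ranks. A ranking model $f$ assigns a real relevance score $f(\boldsymbol{q},\boldsymbol{d})$ to each query-document pair, and the candidates are ranked in decreasing order of score. The integer $\pi_f(\boldsymbol{q},\boldsymbol{d}_i)$ is the rank position of $\boldsymbol{d}_i$ with respect to $\boldsymbol{q}$ predicted by $f$ (position $1$ is the top; low values mean high ranking), and the integer $\pi_y(\boldsymbol{q},\boldsymbol{d}_i)$ is the ground-truth rank position of $\boldsymbol{d}_i$. For a perturbed version $\boldsymbol{d}_i'$ of $\boldsymbol{d}_i$, $\pi_f(\boldsymbol{q},\boldsymbol{d}_i')$ is the rank position predicted by $f$ for $\boldsymbol{d}_i'$ when it takes the place of $\boldsymbol{d}_i$ among the candidates. Neighborhood of a document. A document is a finite word sequence $\boldsymbol{d}=(w_1,\dots,w_M)$, with $\|\boldsymbol{d}\|=M$ its number of words. The set $\mathbb{B}(\boldsymbol{d},\epsilon)$ consists of the documents $\boldsymbol{d}'=(w_1',\dots,w_M')$ obtained from $\boldsymbol{d}$ by replacing at most $\epsilon\cdot M$ words by synonyms, i.e. $$\mathbb{B}(\boldsymbol{d},\epsilon):=\{\boldsymbol{d}' : \|\boldsymbol{d}'-\boldsymbol{d}\|_0/\|\boldsymbol{d}\|\le\epsilon\},\qquad \|\boldsymbol{d}'-\boldsymbol{d}\|_0:=\sum_{m=1}^M\mathbb{I}\{w_m'\neq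 w_m\}.$$ Decision boundary. Put $\pi_n(\boldsymbol{q},\boldsymbol{d}_i):=\pi_y(\boldsymbol{q},\boldsymbol{d}_i)-1$ (the neighborhood rank). The ranking decision boundary of $f$ is $$\mathrm{DB}(f):=\{\boldsymbol{d}_i\sim\mathcal{D}:\pi_f(\boldsymbol{q},\boldsymbol{d}_i)=\pi_n(\boldsymbol{q},\boldsymbol{d}_i)\}.$$ The neighborhood of the decision boundary is, by definition, $$\mathbb{B}(\mathrm{DB}(f),\epsilon):=\{\boldsymbol{d}_i\sim\mathcal{D}:\exists\,\boldsymbol{d}_i'\in\mathbb{B}(\boldsymbol{d}_i,\epsilon)\text{ such that }[\pi_f(\boldsymbol{q},\boldsymbol{d}_i)-\pi_n(\boldsymbol{q},\boldsymbol{d}_i)]\cdot[\pi_f(\boldsymbol{q},\boldsymbol{d}_i')-\pi_n(\boldsymbol{q},\boldsymbol{d}_i)]\le 0\}.$$ Boundary ranking error. $$\mathcal{R}_{\mathrm{bdy}}(f):=\mathbb{E}_{\boldsymbol{d}_i\sim\mathcal{D}}\,\mathbb{I}\left\{\boldsymbol{d}_i\in\mathbb{B}(\mathrm{DB}(f),\epsilon),\ \pi_f(\boldsymbol{q},\boldsymbol{d}_i)=\pi_y(\boldsymbol{q},\boldsymbol{d}_i)\right\}.$$ The mechanism $r$ only names the score-comparison rule used to produce rank positions; it does not appear elsewhere in the definitions or the conclusion. *)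

theory Defs
  imports "HOL-Probability.Probability"
begin

definition word_distance :: "'w list \<Rightarrow> 'w list \<Rightarrow> nat" where
  "word_distance d' d = (\<Sum>m<length d. of_bool (d' ! m \<noteq> d ! m))"

text \<open>\<open>syn w w'\<close> says that \<open>w'\<close> is an admissible synonym of \<open>w\<close>. For \<open>syn = (\<lambda>_ _. True)\<close> the
  set is the plain Hamming neighbourhood. If \<open>d\<close> is empty, the quotient is \<open>0 / 0 = 0\<close>, so for
  \<open>\<epsilon> \<ge> 0\<close> the neighbourhood of \<open>d\<close> always contains \<open>d\<close>.\<close>

definition doc_nbhd :: "('w \<Rightarrow> 'w \<Rightarrow> bool) \<Rightarrow> 'w list \<Rightarrow> real \<Rightarrow> 'w list set" where
  "doc_nbhd syn d \<epsilon> =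
     {d'. length d' = length d \<and>
          (\<forall>m<length d. d' ! m \<noteq> d ! m \<longrightarrow> syn (d ! m) (d' ! m)) \<and>
          real (word_distance d' d) / real (length d) \<le> \<epsilon>}"

definition ranking_mechanism :: "(real \<Rightarrow> real \<Rightarrow> int) \<Rightarrow> bool" where
  "ranking_mechanism r \<longleftrightarrow>
     (\<forall>a b. r a b \<in> {-1, 0, 1} \<and> (r a b = 1 \<longleftrightarrow> a > b) \<and> (r a b = -1 \<longleftrightarrow> a < b))"

text \<open>Position 1 is the top. Without ties among the scores \<open>s\<close> on \<open>D\<close> the two conditions determine
  the positions on \<open>D\<close> uniquely; for tied candidates any convention (arbitrary tie-breaking,
  shared positions) is allowed.\<close>

definition is_ranking ::
    "(real \<Rightarrow> real \<Rightarrow> int) \<Rightarrow> 'd set \<Rightarrow> ('d \<Rightarrow> real) \<Rightarrow> ('d \<Rightarrow> int) \<Rightarrow> bool" where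
  "is_ranking r D s \<pi> \<longleftrightarrow>
     \<pi> ` D \<subseteq> {1..int (card D)} \<and> (\<forall>x\<in>D. \<forall>y\<in>D. r (s x) (s y) = 1 \<longrightarrow> \<pi> x < \<pi> y)"

text \<open>A ranking rule fixes a tie convention: it sends every assignment of scores to the
  candidates to a ranking of the candidates by these scores.\<close>

definition ranking_rule ::
    "(real \<Rightarrow> real \<Rightarrow> int) \<Rightarrow> 'd set \<Rightarrow> (('d \<Rightarrow> real) \<Rightarrow> 'd \<Rightarrow> int) \<Rightarrow> bool" where
  "ranking_rule r D R \<longleftrightarrow> (\<forall>s. is_ranking r D s (R s))"

lemma ranking_rule_standard_competition:
  assumes "ranking_mechanism r" and "finite D"
  shows "ranking_rule r D (\<lambda>s x. 1 + int (card {y \<in> D. s y > s x}))"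
proof -
  have below: "card {y \<in> D. s y > s x} < card D" if "x \<in> D" for s :: "'a \<Rightarrow> real" and x
  proof (rule psubset_card_mono[OF assms(2)])
    show "{y \<in> D. s y > s x} \<subset> D"
      using that by blast
  qed
  have mono: "card {z \<in> D. s z > s x} < card {z \<in> D. s z > s y}"
    if "x \<in> D" "r (s x) (s y) = 1" for s :: "'a \<Rightarrow> real" and x y
  proof (rule psubset_card_mono)
    have "s x > s y"
      using assms(1) that(2) by (simp add: ranking_mechanism_def)
    then have "{z \<in> D. s z > s x} \<subseteq> {z \<in> D. s z > s y}" and "x \<in> {z \<in> D. s z > s y}"
      using that(1) by auto
    then show "{z \<in> D. s z > s x} \<subset> {z \<in> D. s z > s y}"
      by blast
  qed (use assms(2) in simp)
  show ?thesis
    unfolding ranking_rule_def is_ranking_def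
  proof (intro allI conjI ballI impI)
    fix s :: "'a \<Rightarrow> real"
    show "(\<lambda>x. 1 + int (card {y \<in> D. s y > s x})) ` D \<subseteq> {1..int (card D)}"
    proof (rule image_subsetI)
      fix x assume "x \<in> D"
      from below[OF this, of s] show "1 + int (card {y \<in> D. s y > s x}) \<in> {1..int (card D)}"
        by simp
    qed
  next
    fix s :: "'a \<Rightarrow> real" and x y
    assume "x \<in> D" "r (s x) (s y) = 1"
    from mono[where s = s, OF this]
    show "1 + int (card {z \<in> D. s z > s x}) < 1 + int (card {z \<in> D. s z > s y})"
      by simp
  qed
qed

definition rank_pred ::
    "(('w list \<Rightarrow> real) \<Rightarrow> 'w list \<Rightarrow> int) \<Rightarrow> ('q \<Rightarrow> 'w list \<Rightarrow> real) \<Rightarrow> 'q \<Rightarrow> 'w list \<Rightarrow> int" where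
  "rank_pred R f q d = R (f q) d"

text \<open>The perturbed document \<open>d'\<close> occupies the place of the candidate \<open>d\<close>, which therefore gets the
  score of \<open>d'\<close>; this also covers the case that \<open>d'\<close> happens to equal another candidate.\<close>

definition rank_pred_perturbed ::
    "(('w list \<Rightarrow> real) \<Rightarrow> 'w list \<Rightarrow> int) \<Rightarrow> ('q \<Rightarrow> 'w list \<Rightarrow> real) \<Rightarrow> 'q
      \<Rightarrow> 'w list \<Rightarrow> 'w list \<Rightarrow> int" where
  "rank_pred_perturbed R f q d d' = R ((f q)(d := f q d')) d"

definition nbhd_rank :: "('q \<Rightarrow> 'w list \<Rightarrow> int) \<Rightarrow> 'q \<Rightarrow> 'w list \<Rightarrow> int" where
  "nbhd_rank \<pi>\<^sub>y q d = \<pi>\<^sub>y q d - 1"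

definition boundary_nbhd ::
    "('w \<Rightarrow> 'w \<Rightarrow> bool) \<Rightarrow> (('w list \<Rightarrow> real) \<Rightarrow> 'w list \<Rightarrow> int) \<Rightarrow> ('q \<Rightarrow> 'w list \<Rightarrow> real)
      \<Rightarrow> ('q \<Rightarrow> 'w list \<Rightarrow> int) \<Rightarrow> 'q \<Rightarrow> 'w list set \<Rightarrow> real \<Rightarrow> 'w list set" where
  "boundary_nbhd syn R f \<pi>\<^sub>y q D \<epsilon> =
     {d \<in> D. \<exists>d' \<in> doc_nbhd syn d \<epsilon>.
        (rank_pred R f q d - nbhd_rank \<pi>\<^sub>y q d)
          * (rank_pred_perturbed R f q d d' - nbhd_rank \<pi>\<^sub>y q d) \<le> 0}"

definition boundary_error ::
    "('w \<Rightarrow> 'w \<Rightarrow> bool) \<Rightarrow> (('w list \<Rightarrow> real) \<Rightarrow> 'w list \<Rightarrow> int) \<Rightarrow> ('q \<Rightarrow> 'w list \<Rightarrow> real)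
      \<Rightarrow> ('q \<Rightarrow> 'w list \<Rightarrow> int) \<Rightarrow> 'q \<Rightarrow> 'w list set \<Rightarrow> 'w list pmf \<Rightarrow> real \<Rightarrow> real" where
  "boundary_error syn R f \<pi>\<^sub>y q D P \<epsilon> =
     measure_pmf.expectation P
       (\<lambda>d. of_bool (d \<in> boundary_nbhd syn R f \<pi>\<^sub>y q D \<epsilon> \<and> rank_pred R f q d = \<pi>\<^sub>y q d))"

end

theory Submission imports Defs begin

text \<open>If \<open>d\<close> is ranked correctly, its predicted rank exceeds its neighborhood rank by 1, so a
  perturbation that reaches or crosses the boundary must change the rank. The inequality of
  expectations is thus the expectation of a pointwise one.\<close>

lemma self_in_doc_nbhd: "0 \<le> \<epsilon> \<Longrightarrow> d \<in> doc_nbhd syn d \<epsilon>"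
  by (simp add: doc_nbhd_def word_distance_def)

text \<open>\<open>A\<close> may be infinite, as \<open>doc_nbhd\<close> is over an infinite
  vocabulary. Only two values occur, so \<open>Max\<close> of the image is still a true maximum once
  \<open>A\<close> is nonempty.\<close>

lemma finite_of_bool_image: "finite ((\<lambda>x. of_bool (Q x)) ` A)"
  by (rule finite_subset[of _ "{0, 1}"]) auto

lemma rank_changes_at_boundary:
  assumes "d \<in> boundary_nbhd syn R f \<pi>\<^sub>y q D \<epsilon>" and "rank_pred R f q d = \<pi>\<^sub>y q d"
  shows "\<exists>d' \<in> doc_nbhd syn d \<epsilon>. rank_pred R f q d \<noteq> rank_pred_perturbed R f q d d'"
proof -
  \<comment> \<open>Correct ranking turns the first factor of the product into 1, leaving the sign
    condition on the second factor.\<close>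
  obtain d' where "d' \<in> doc_nbhd syn d \<epsilon>"
      and "rank_pred_perturbed R f q d d' - (\<pi>\<^sub>y q d - 1) \<le> 0"
    using assms by (auto simp: boundary_nbhd_def nbhd_rank_def)
  then show ?thesis
    using assms(2) by (intro bexI[of _ d']) auto
qed

theorem theorem1:
  fixes q :: 'q
    and D :: "'w list set"
    and P :: "'w list pmf"
    and \<epsilon> :: real
    and f :: "'q \<Rightarrow> 'w list \<Rightarrow> real"
    and r :: "real \<Rightarrow> real \<Rightarrow> int"
    and R :: "('w list \<Rightarrow> real) \<Rightarrow> 'w list \<Rightarrow> int"
    and \<pi>\<^sub>y :: "'q \<Rightarrow> 'w list \<Rightarrow> int"
    and syn :: "'w \<Rightarrow> 'w \<Rightarrow> bool"
  assumes "finite D"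
    and "set_pmf P \<subseteq> D"
    and "0 \<le> \<epsilon>" and "\<epsilon> \<le> 1"
    and "ranking_mechanism r"
    and "ranking_rule r D R"
  shows "boundary_error syn R f \<pi>\<^sub>y q D P \<epsilon>
    \<le> measure_pmf.expectation P
        (\<lambda>d. Max ((\<lambda>d'. of_bool (rank_pred R f q d \<noteq> rank_pred_perturbed R f q d d'))
                    ` doc_nbhd syn d \<epsilon>))"
proof -
  have "of_bool (d \<in> boundary_nbhd syn R f \<pi>\<^sub>y q D \<epsilon> \<and> rank_pred R f q d = \<pi>\<^sub>y q d)
      \<le> Max ((\<lambda>d'. of_bool (rank_pred R f q d \<noteq> rank_pred_perturbed R f q d d') :: real)
              ` doc_nbhd syn d \<epsilon>)" (is "of_bool ?B \<le> Max (?h ` _)") for d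
  proof -
    \<comment> \<open>If \<open>?B\<close> holds, the witness is a perturbation that changes the
      rank. Otherwise the left side is 0 and \<open>d\<close> itself serves, which is where
      \<open>0 \<le> \<epsilon>\<close> enters.\<close>
    obtain d' where "d' \<in> doc_nbhd syn d \<epsilon>" and "of_bool ?B \<le> ?h d'"
      using rank_changes_at_boundary[of d syn R f \<pi>\<^sub>y q D \<epsilon>] self_in_doc_nbhd[OF \<open>0 \<le> \<epsilon>\<close>, of d syn]
      by (cases ?B) (fastforce, auto)
    note \<open>of_bool ?B \<le> ?h d'\<close>
    also have "?h d' \<le> Max (?h ` doc_nbhd syn d \<epsilon>)"
      using \<open>d' \<in> doc_nbhd syn d \<epsilon>\<close> by (intro Max_ge finite_of_bool_image imageI)
    finally show ?thesis .
  qed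
  \<comment> \<open>Finite support makes both integrands integrable, as monotonicity of the integral
    demands.\<close>
  moreover have "finite (set_pmf P)"
    using assms(1,2) by (rule rev_finite_subset)
  ultimately show ?thesis
    unfolding boundary_error_def by (intro integral_mono integrable_measure_pmf_finite)
qed

end
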